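(* Let $A\in\mathbb{R}^{m\times n}$ with $m\ge n$ have full rank, let $\widetilde V\in\mathbb{R}^{n\times n}$ satisfy $\|\widetilde V^T\widetilde V-I\|_2\le p_1u<1$, let $\widetilde A=A\widetilde V$ (exact product), and let $\widetilde A_{\mathrm{comp}}$ be obtained by computing the product $A\widetilde V$ in floating-point arithmetic of unit roundoff $u_h$ (with $0<u_h<u$) and rounding the result to the working precision with unit roundoff $u$. Let $\widehat\sigma_k(\widetilde A_{\mathrm{comp}})$ be the $k$th largest singular value computed by the one-sided Jacobi algorithm applied to $\widetilde A_{\mathrm{comp}}$ at precision $u$. Put $\gamma=\frac{nu}{1-nu}$, $\gamma_h=\frac{nu_h}{1-nu_h}$, with $\gamma_h<\gamma<1$, and assume: (A1) $6nu(1-p_1u)^{-1}\kappa_2(A)<1$; (A2) $\gamma_h<\dfrac{(1-p_1u)u}{4(1+p_1u)\kappa_2(A)}$; (A3) $4\sqrt m\,u<1$ and $16m\sqrt n\,u\,\kappa_2^D(\widetilde A)<1$; (A4) for the matrix $B=\widetilde A_{\mathrm{comp}}$ to which the one-sided Jacobi algorithm is applied, $\max_{0\le i\le M}\kappa_2^D(B^{(i)})\le c_J\,\kappa_2^D(B)$, where $B^{(i)}$ is the matrix after $i$ Jacobi rotations, $M$ is the number of rotations before the stopping criterion is satisfied, and $c_J$ is a modest constant. Then for every $k=1,\dots,n$ the relative forward error $\varepsilon_{fwd}^{(k)}=\dfrac{|\widehat\sigma_k(\widetilde A_{\mathrm{comp}})-\sigma_k(A)|}{\sigma_k(A)}$ satisfies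 $$\varepsilon_{fwd}^{(k)}\le p_1u+p_2\,\kappa_2^D(\widetilde A)\,u,$$ provided that both terms on the right-hand side are less than $1$.
   Context: Notation. $\sigma_k(\cdot)$ is the $k$th largest exact singular value; $\kappa_2(X)=\sigma_{\max}(X)/\sigma_{\min}(X)$ for $X$ of full column rank; $\kappa_2^D(X)=\kappa_2(XD)$ with $D=\mathrm{diag}(\|x_i\|_2^{-1})$, $x_i$ the $i$th column of $X$ (one-sided scaled condition number). Floating-point model. Entries of $A$ and $\widetilde V$ are working-precision numbers; promotion to high precision is exact; no overflow or underflow occurs. Each operation at unit roundoff $w$ satisfies $\mathrm{fl}(a\,\mathrm{op}\,b)=(a\,\mathrm{op}\,b)(1+\delta)$, $|\delta|\le w$, and rounding to working precision satisfies $\mathrm{fl}(x)=x(1+\delta)$, $|\delta|\le u$. In particular the high-precision computed product $\widetilde A_{h,\mathrm{comp}}$ satisfies $|\widetilde A_{h,\mathrm{comp}}-A\widetilde V|\le\gamma_h|A||\widetilde V|$ and $|\widetilde A_{\mathrm{comp}}-\widetilde A_{h,\mathrm{comp}}|\le u|\widetilde A_{h,\mathrm{comp}}|$ componentwise. One-sided Jacobi algorithm. It applies a sequence of plane rotations on the right to orthogonalize pairs of columns, and stops when $|b_i^Tb_j|\le \mathrm{tol}\,\|b_i\|_2\|b_j\|_2$ for all $i\ne j$, $b_i$ being the columns of the current matrix and tol being of order $u$; the computed singular values are the computed column norms. Known rounding-error bound (Demmel and Veselić, Cor. 4.2) combined with (A4): there is a low-degree polynomial factor $p_3'=p_3'(m,n)$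 (absorbing $c_J$) such that, when the full-column-rank matrix $B$ is the input, $|\widehat\sigma_k(B)-\sigma_k(B)|/\sigma_k(B)\le p_3'\,u\,\kappa_2^D(B)$ for all $k$, provided $p_3'\,u\,\kappa_2^D(B)<1$. Constants. Each $p_i=p_i(m,n)$ denotes a low-degree polynomial in $m$ and $n$; $p_1$ is the factor in the hypothesis on $\widetilde V$; $p_3:=3p_3'$ and $p_2:=3p_3+3\sqrt{mn}$. *)

theory Defs
  imports "HOL-Analysis.Analysis" "HOL-Computational_Algebra.Polynomial" "HOL-Library.Multiset"
begin

section \<open>Singular values and condition numbers\<close>

definition charpoly :: "real^'n^'n \<Rightarrow> real poly" where
  "charpoly S = det (\<chi> i j. (if i = j then [:0, 1:] else 0) - [:S $ i $ j:])"

text \<open>Entries are counted from \<open>k = 1\<close>; the value is meaningful for \<open>1 \<le> k \<le> size M\<close> only.\<close>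

definition kth_largest :: "real multiset \<Rightarrow> nat \<Rightarrow> real" where
  "kth_largest M k = rev (sorted_list_of_multiset M) ! (k - 1)"

text \<open>The singular values of an \<open>m \<times> n\<close> matrix with \<open>m \<ge> n\<close> are the square roots of the
  eigenvalues of \<open>X\<^sup>T X\<close>, repeated according to multiplicity. Since \<open>X\<^sup>T X\<close> is symmetric,
  its characteristic polynomial splits over the reals, so there are exactly \<open>n\<close> of them.\<close>

definition singular_values :: "real^'n^'m \<Rightarrow> real multiset" where
  "singular_values X = image_mset sqrt (proots (charpoly (transpose X ** X)))"

definition sing_val :: "real^'n^'m \<Rightarrow> nat \<Rightarrow> real" where
  "sing_val X k = kth_largest (singular_values X) k"

definition full_column_rank :: "real^'n^'m \<Rightarrow> bool" where
  "full_column_rank X \<longleftrightarrow> rank X = CARD('n)"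

text \<open>Both condition numbers are meant for matrices of full column rank only.\<close>

definition cond2 :: "real^'n^'m \<Rightarrow> real" where
  "cond2 X = sing_val X 1 / sing_val X CARD('n)"

definition column_scaling :: "real^'n^'m \<Rightarrow> real^'n^'n" where
  "column_scaling X = (\<chi> i j. if i = j then inverse (norm (column i X)) else 0)"

definition cond2D :: "real^'n^'m \<Rightarrow> real" where
  "cond2D X = cond2 (X ** column_scaling X)"

definition spectral_norm :: "real^'n^'m \<Rightarrow> real" where
  "spectral_norm X = onorm (\<lambda>v. X *v v)"


section \<open>Floating-point model\<close>

text \<open>\<open>fl F w x y\<close>: the number \<open>y\<close> is an admissible result of rounding the exact
  value \<open>x\<close> in an arithmetic with set of numbers \<open>F\<close> and unit roundoff \<open>w\<close>. Taking for
  \<open>x\<close> the exact result of an operation gives the standard model; as it is a relation, an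
  operation need not be correctly rounded. Overflow and underflow are excluded.\<close>

definition fl :: "real set \<Rightarrow> real \<Rightarrow> real \<Rightarrow> real \<Rightarrow> bool" where
  "fl F w x y \<longleftrightarrow> y \<in> F \<and> (\<exists>\<delta>. \<bar>\<delta>\<bar> \<le> w \<and> y = x * (1 + \<delta>))"

definition entries_in :: "real set \<Rightarrow> real^'n^'m \<Rightarrow> bool" where
  "entries_in F X \<longleftrightarrow> (\<forall>i j. X $ i $ j \<in> F)"

text \<open>\<open>fl_inner F w x y I s\<close>: the value \<open>s\<close> is computed for \<open>\<Sum>i\<in>I. x i * y i\<close>,
  the products being added in an arbitrary order.\<close>

inductive fl_inner ::
  "real set \<Rightarrow> real \<Rightarrow> ('i \<Rightarrow> real) \<Rightarrow> ('i \<Rightarrow> real) \<Rightarrow> 'i set \<Rightarrow> real \<Rightarrow> bool"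
  for F w x y where
  prod: "fl F w (x i * y i) s \<Longrightarrow> fl_inner F w x y {i} s"
| add: "fl_inner F w x y I s \<Longrightarrow> fl_inner F w x y J t \<Longrightarrow> I \<inter> J = {}
    \<Longrightarrow> fl F w (s + t) r \<Longrightarrow> fl_inner F w x y (I \<union> J) r"

definition fl_matmul :: "real set \<Rightarrow> real \<Rightarrow> real^'n^'m \<Rightarrow> real^'p^'n \<Rightarrow> real^'p^'m \<Rightarrow> bool" where
  "fl_matmul F w X Y Z \<longleftrightarrow>
     (\<forall>i j. fl_inner F w (\<lambda>k. X $ i $ k) (\<lambda>k. Y $ k $ j) UNIV (Z $ i $ j))"

definition fl_matrix :: "real set \<Rightarrow> real \<Rightarrow> real^'n^'m \<Rightarrow> real^'n^'m \<Rightarrow> bool" where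
  "fl_matrix F w X Y \<longleftrightarrow> (\<forall>i j. fl F w (X $ i $ j) (Y $ i $ j))"


section \<open>One-sided Jacobi algorithm\<close>

text \<open>For the Gram entries \<open>a = x \<bullet> x\<close>, \<open>b = y \<bullet> y\<close>, \<open>c = x \<bullet> y \<noteq> 0\<close> of two columns,
  \<open>\<zeta> = (b - a) / (2 c)\<close>, \<open>t = sign \<zeta> / (\<bar>\<zeta>\<bar> + sqrt (1 + \<zeta>\<^sup>2))\<close>,
  \<open>cs = 1 / sqrt (1 + t\<^sup>2)\<close> and \<open>sn = cs t\<close> define the rotation for which
  \<open>cs x - sn y\<close> and \<open>sn x + cs y\<close> are orthogonal (this is the rotation used by Demmel and
  Veselic). Below, every operation is rounded; \<open>sign 0\<close> is \<open>1\<close>.\<close>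

definition fl_jacobi_angle ::
  "real set \<Rightarrow> real \<Rightarrow> real \<Rightarrow> real \<Rightarrow> real \<Rightarrow> real \<Rightarrow> real \<Rightarrow> bool" where
  "fl_jacobi_angle F w a b c cs sn \<longleftrightarrow> c \<noteq> 0 \<and>
     (\<exists>d e \<zeta> z1 z2 z3 g t t1 t2 t3.
        fl F w (b - a) d \<and> fl F w (2 * c) e \<and> fl F w (d / e) \<zeta> \<and>
        fl F w (\<zeta> * \<zeta>) z1 \<and> fl F w (1 + z1) z2 \<and> fl F w (sqrt z2) z3 \<and>
        fl F w (\<bar>\<zeta>\<bar> + z3) g \<and> fl F w ((if \<zeta> \<ge> 0 then 1 else - 1) / g) t \<and>
        fl F w (t * t) t1 \<and> fl F w (1 + t1) t2 \<and> fl F w (sqrt t2) t3 \<and>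
        fl F w (1 / t3) cs \<and> fl F w (cs * t) sn)"

definition fl_rotation :: "real set \<Rightarrow> real \<Rightarrow> real^'n^'m \<Rightarrow> real^'n^'m \<Rightarrow> bool" where
  "fl_rotation F w X Y \<longleftrightarrow>
     (\<exists>p q a b c cs sn. p \<noteq> q \<and>
        fl_inner F w (\<lambda>i. X $ i $ p) (\<lambda>i. X $ i $ p) UNIV a \<and>
        fl_inner F w (\<lambda>i. X $ i $ q) (\<lambda>i. X $ i $ q) UNIV b \<and>
        fl_inner F w (\<lambda>i. X $ i $ p) (\<lambda>i. X $ i $ q) UNIV c \<and>
        fl_jacobi_angle F w a b c cs sn \<and>
        (\<forall>i. \<exists>r s. fl F w (cs * X $ i $ p) r \<and> fl F w (sn * X $ i $ q) s \<and>
                   fl F w (r - s) (Y $ i $ p)) \<and>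
        (\<forall>i. \<exists>r s. fl F w (sn * X $ i $ p) r \<and> fl F w (cs * X $ i $ q) s \<and>
                   fl F w (r + s) (Y $ i $ q)) \<and>
        (\<forall>i j. j \<noteq> p \<longrightarrow> j \<noteq> q \<longrightarrow> Y $ i $ j = X $ i $ j))"

definition jacobi_stop :: "real \<Rightarrow> real^'n^'m \<Rightarrow> bool" where
  "jacobi_stop tol X \<longleftrightarrow>
     (\<forall>i j. i \<noteq> j \<longrightarrow>
        \<bar>column i X \<bullet> column j X\<bar> \<le> tol * norm (column i X) * norm (column j X))"

text \<open>\<open>iterate R i\<close> is the computed matrix after \<open>i\<close> rotations, \<open>nrot R\<close> the number of
  rotations, and \<open>col_norms R\<close> holds the computed column norms of the last matrix.\<close>

record ('m, 'n) jacobi_data =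
  iterate :: "nat \<Rightarrow> real^'n^'m"
  nrot :: nat
  col_norms :: "real^'n"

definition jacobi_run ::
  "real set \<Rightarrow> real \<Rightarrow> real \<Rightarrow> real^'n^'m \<Rightarrow> ('m::finite, 'n::finite) jacobi_data \<Rightarrow> bool" where
  "jacobi_run F w tol B R \<longleftrightarrow>
     iterate R 0 = B \<and>
     (\<forall>i < nrot R. \<not> jacobi_stop tol (iterate R i) \<and>
                   fl_rotation F w (iterate R i) (iterate R (Suc i))) \<and>
     jacobi_stop tol (iterate R (nrot R)) \<and>
     (\<forall>j. \<exists>s. fl_inner F w (\<lambda>i. iterate R (nrot R) $ i $ j) (\<lambda>i. iterate R (nrot R) $ i $ j) UNIV s
              \<and> fl F w (sqrt s) (col_norms R $ j))"

definition computed_sing_val :: "('m::finite, 'n::finite) jacobi_data \<Rightarrow> nat \<Rightarrow> real" where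
  "computed_sing_val R k =
     kth_largest (image_mset (\<lambda>j. col_norms R $ j) (mset_set UNIV)) k"

text \<open>The rank condition is part of the requirement because the scaled condition number of
  an iterate without full column rank is infinite.\<close>

definition jacobi_cond_growth :: "real \<Rightarrow> ('m::finite, 'n::finite) jacobi_data \<Rightarrow> bool" where
  "jacobi_cond_growth cJ R \<longleftrightarrow>
     (\<forall>i \<in> {0..nrot R}. full_column_rank (iterate R i)) \<and>
     (MAX i \<in> {0..nrot R}. cond2D (iterate R i)) \<le> cJ * cond2D (iterate R 0)"

text \<open>The error bound of Demmel and Veselic (Cor. 4.2 of their paper) for an implementation
  \<open>J\<close> of the algorithm, which assigns to each input matrix the data of its run. The factor
  \<open>p\<close> may depend on the dimensions, on \<open>cJ\<close> and on the constant in \<open>tol\<close>, but not on the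
  input \<open>B\<close>.\<close>

definition demmel_veselic_bound ::
  "real set \<Rightarrow> real \<Rightarrow> real \<Rightarrow> real \<Rightarrow> real
     \<Rightarrow> (real^'n^'m \<Rightarrow> ('m::finite, 'n::finite) jacobi_data) \<Rightarrow> bool" where
  "demmel_veselic_bound F u tol cJ p J \<longleftrightarrow>
     (\<forall>B. entries_in F B \<longrightarrow> full_column_rank B \<longrightarrow> jacobi_run F u tol B (J B) \<longrightarrow>
          jacobi_cond_growth cJ (J B) \<longrightarrow> p * u * cond2D B < 1 \<longrightarrow>
          (\<forall>k \<in> {1..CARD('n)}.
             \<bar>computed_sing_val (J B) k - sing_val B k\<bar> / sing_val B k \<le> p * u * cond2D B))"

end

theory Submission
  imports Defs
begin

text \<open>The computed singular value is reached from \<open>\<sigma>\<^sub>k(A)\<close> in three steps, each of which changes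
\<open>\<sigma>\<^sub>k\<close> by a small relative amount: from \<open>A\<close> to the exact product \<open>X = A V\<close>, from \<open>X\<close> to the
computed product \<open>C\<close>, and from \<open>\<sigma>\<^sub>k(C)\<close> to the output of the Jacobi algorithm.

The first two steps rest on one comparison principle (\<open>sing_val_compare\<close>): if
\<open>\<parallel>X (P v)\<parallel> \<le> a \<parallel>Y (W v)\<parallel>\<close> and \<open>\<parallel>W v\<parallel> \<le> b \<parallel>P v\<parallel>\<close> for all \<open>v\<close>, with \<open>P\<close> and \<open>W\<close> linear
bijections, then \<open>\<sigma>\<^sub>k(X) \<le> a b \<sigma>\<^sub>k(Y)\<close>. It follows from the Courant-Fischer subspaces: one of
dimension \<open>k\<close> on which \<open>X\<close> stretches by at least \<open>\<sigma>\<^sub>k(X)\<close>, and one of dimension \<open>n + 1 - k\<close> on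
which \<open>Y\<close> stretches by at most \<open>\<sigma>\<^sub>k(Y)\<close>, must meet after being pulled back. As singular values are
defined through the characteristic polynomial of \<open>X\<^sup>T X\<close>, the spectral theorem for symmetric
matrices is needed to produce these subspaces.

Step 1. The hypothesis on \<open>V\<close> says that \<open>V\<close> is nearly an isometry,
\<open>(1 - e) \<parallel>v\<parallel> \<le> \<parallel>V v\<parallel> \<le> (1 + e) \<parallel>v\<parallel>\<close> with \<open>e = p\<^sub>1 u\<close>, which gives a relative change of at
most \<open>e\<close>.

Step 2. The error \<open>C - X\<close> is small relative to \<open>X\<close> column by column: its \<open>j\<close>th column is at most
\<open>d\<close> times the norm of the \<open>j\<close>th column of \<open>X\<close>, where \<open>d = u + (1 + u) \<surd>n u / 4\<close>. The first
summand is the rounding to working precision. The second comes from the multiplication, whose error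
\<open>\<gamma>\<^sub>h |A| |V|\<close> could be as large as \<open>\<gamma>\<^sub>h \<surd>n \<kappa>\<^sub>2(A)\<close> times that norm; the precision
\<open>u\<^sub>h\<close> is chosen so high that \<open>\<gamma>\<^sub>h \<kappa>\<^sub>2(A) \<le> u / 4\<close>. Normalizing the columns of \<open>X\<close> turns a
columnwise error into \<open>\<parallel>(C - X) v\<parallel> \<le> h \<parallel>X v\<parallel>\<close> with \<open>h = d \<surd>n \<kappa>\<close>, \<open>\<kappa> = \<kappa>\<^sub>2\<^sup>D(X)\<close>, so that only the
scaled condition number enters. Consequently \<open>|\<sigma>\<^sub>k(C) - \<sigma>\<^sub>k(X)| \<le> h \<sigma>\<^sub>k(X)\<close>, and \<open>h\<close> is at most
\<open>21/16 \<surd>(m n) u \<kappa>\<close>.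

Step 3. The bound of Demmel and Veselic is relative to \<open>\<kappa>\<^sub>2\<^sup>D(C)\<close>. The comparison principle,
applied to the matrices with normalized columns, gives
\<open>\<kappa>\<^sub>2\<^sup>D(C) \<le> ((1 + h) / (1 - h))\<^sup>2 \<kappa> \<le> 3/2 \<kappa>\<close>, since \<open>h \<le> 21/256\<close>.

Adding up, with \<open>\<sigma>\<^sub>k(X) \<le> 2 \<sigma>\<^sub>k(A)\<close>, \<open>\<sigma>\<^sub>k(C) \<le> 3 \<sigma>\<^sub>k(A)\<close> and \<open>r \<le> 3/2 p\<^sub>3' u \<kappa>\<close> for the
error of step 3, the total relative error is at most \<open>e + 2 h + 3 r\<close>, which the constants
\<open>9 p\<^sub>3' + 3 \<surd>(m n)\<close> accommodate.\<close>


section \<open>Spectral theorem for symmetric matrices\<close>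

text \<open>A maximizer \<open>x\<close> of the Rayleigh quotient on the unit sphere of \<open>U\<close> is an eigenvector: moving from
\<open>x\<close> in the direction of the residual \<open>y = \<mu> x - f x\<close> changes \<open>\<mu> \<parallel>x\<parallel>\<^sup>2 - x \<bullet> f x\<close> to first order by
\<open>2 t (y \<bullet> y)\<close>, and a quantity that is nonnegative and vanishes at \<open>t = 0\<close> has no first-order term.\<close>

lemma self_adjoint_eigenvector:
  fixes f :: "'a::euclidean_space \<Rightarrow> 'a"
  assumes f: "linear f" and adj: "\<And>x y. f x \<bullet> y = x \<bullet> f y"
    and U: "subspace U" "\<And>x. x \<in> U \<Longrightarrow> f x \<in> U" "U \<noteq> {0}"
  obtains x \<mu> where "x \<in> U" "norm x = 1" "f x = \<mu> *\<^sub>R x"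
proof -
  let ?K = "sphere 0 1 \<inter> U"
  obtain z where z: "z \<in> U" "z \<noteq> 0"
    using U(1,3) subspace_0 by blast
  have "(inverse (norm z)) *\<^sub>R z \<in> ?K"
    using z U(1) by (simp add: subspace_scale)
  moreover have "compact ?K"
    by (intro compact_Int_closed compact_sphere closed_subspace U)
  moreover have "continuous_on ?K (\<lambda>x. x \<bullet> f x)"
    by (intro continuous_intros linear_continuous_on linear_conv_bounded_linear[THEN iffD1] f)
  ultimately obtain x where x: "x \<in> ?K" and max: "\<And>y. y \<in> ?K \<Longrightarrow> y \<bullet> f y \<le> x \<bullet> f x"
    using continuous_attains_sup[of ?K "\<lambda>x. x \<bullet> f x"] by blast
  define \<mu> where "\<mu> = x \<bullet> f x"
  have rayleigh: "y \<bullet> f y \<le> \<mu> * (y \<bullet> y)" if "y \<in> U" for y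
  proof (cases "y = 0")
    case False
    let ?r = "inverse (norm y)"
    have "(?r *\<^sub>R y) \<bullet> f (?r *\<^sub>R y) \<le> \<mu>"
      unfolding \<mu>_def using False that U(1) by (intro max) (simp add: subspace_scale)
    then have "?r * ?r * (y \<bullet> f y) \<le> \<mu>"
      by (simp add: linear_scale[OF f])
    then show ?thesis
      using False by (simp add: dot_square_norm power2_eq_square field_simps)
  qed (simp add: linear_0[OF f])
  define y where "y = \<mu> *\<^sub>R x - f x"
  have yU: "y \<in> U"
    unfolding y_def using x U by (intro subspace_diff subspace_scale) auto
  have xx: "x \<bullet> x = 1"
    using x by (simp add: dot_square_norm)
  define c where "c = \<mu> * (y \<bullet> y) - y \<bullet> f y"
  have quad: "0 \<le> 2 * t * (y \<bullet> y) + t\<^sup>2 * c" for t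
  proof -
    have "x + t *\<^sub>R y \<in> U"
      using x yU U(1) by (intro subspace_add subspace_scale) auto
    from rayleigh[OF this] have
      "0 \<le> \<mu> * ((x + t *\<^sub>R y) \<bullet> (x + t *\<^sub>R y)) - (x + t *\<^sub>R y) \<bullet> f (x + t *\<^sub>R y)" by simp
    also have "\<dots> = \<mu> * (1 + 2 * t * (x \<bullet> y) + t\<^sup>2 * (y \<bullet> y))
        - (\<mu> + t * (y \<bullet> f x) + t * (x \<bullet> f y) + t\<^sup>2 * (y \<bullet> f y))"
      by (simp add: linear_add[OF f] linear_scale[OF f] inner_simps xx \<mu>_def power2_eq_square
          inner_commute algebra_simps)
    also have "x \<bullet> f y = y \<bullet> f x"
      by (metis adj inner_commute)
    also have "y \<bullet> f x = \<mu> * (x \<bullet> y) - y \<bullet> y"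
      by (simp add: y_def inner_simps algebra_simps inner_commute)
    finally show ?thesis
      by (simp add: c_def algebra_simps)
  qed
  have "y \<bullet> y = 0"
  proof (rule ccontr)
    assume "y \<bullet> y \<noteq> 0"
    then have pos: "y \<bullet> y > 0" by simp
    \<comment> \<open>a negative step so short that the quadratic term cannot outweigh the linear one\<close>
    define t where "t = - (y \<bullet> y) / (\<bar>c\<bar> + 1)"
    have "\<bar>t * c\<bar> = \<bar>t\<bar> * \<bar>c\<bar>"
      by (rule abs_mult)
    also have "\<dots> = (y \<bullet> y) * (\<bar>c\<bar> / (\<bar>c\<bar> + 1))"
      using pos by (simp add: t_def abs_divide)
    also have "\<dots> < (y \<bullet> y) * 1"
      using pos by (intro mult_strict_left_mono) (auto simp: field_simps)
    finally have "\<bar>t * c\<bar> < y \<bullet> y" by simp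
    then have "2 * (y \<bullet> y) + t * c > 0" using pos by linarith
    moreover have "t < 0" using pos by (simp add: t_def divide_neg_pos)
    ultimately have "t * (2 * (y \<bullet> y) + t * c) < 0" by (simp add: mult_neg_pos)
    then show False
      using quad[of t] by (simp add: algebra_simps power2_eq_square)
  qed
  then have "f x = \<mu> *\<^sub>R x" by (simp add: y_def)
  then show ?thesis using that x by auto
qed

text \<open>The part of \<open>U\<close> orthogonal to an eigenvector is again invariant under a self-adjoint map, so an
eigenvector can be split off and the dimension decreases.\<close>

lemma self_adjoint_orthonormal_eigenbasis:
  fixes f :: "'a::euclidean_space \<Rightarrow> 'a"
  assumes f: "linear f" and adj: "\<And>x y. f x \<bullet> y = x \<bullet> f y"
    and "subspace U" "\<And>x. x \<in> U \<Longrightarrow> f x \<in> U"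
  shows "\<exists>B. pairwise orthogonal B \<and> (\<forall>b\<in>B. norm b = 1 \<and> (\<exists>\<mu>. f b = \<mu> *\<^sub>R b)) \<and> span B = U"
  using assms(3,4)
proof (induction "dim U" arbitrary: U rule: less_induct)
  case (less U)
  show ?case
  proof (cases "U = {0}")
    case True
    then show ?thesis by (intro exI[of _ "{}"]) simp
  next
    case False
    obtain x \<mu> where x: "x \<in> U" "norm x = 1" "f x = \<mu> *\<^sub>R x"
      using self_adjoint_eigenvector[OF f adj less.prems False] by blast
    define W where "W = {y. orthogonal x y} \<inter> U"
    have W: "subspace W"
      unfolding W_def by (intro subspace_inter subspace_orthogonal_to_vector less.prems)
    have "f y \<in> W" if "y \<in> W" for y
      using that less.prems(2) by (simp add: W_def orthogonal_def adj[symmetric] x(3))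
    moreover have "dim W < dim U"
    proof (rule dim_psubset)
      have "x \<notin> W" using x by (auto simp: W_def orthogonal_def)
      then have "W \<subset> U" using x by (auto simp: W_def)
      then show "span W \<subset> span U" using W less.prems(1) by (simp add: span_eq_iff[THEN iffD2])
    qed
    ultimately obtain B where B: "pairwise orthogonal B"
        "\<forall>b\<in>B. norm b = 1 \<and> (\<exists>\<mu>. f b = \<mu> *\<^sub>R b)" "span B = W"
      using less.hyps[of W] W by blast
    have "B \<subseteq> W" using B(3) span_superset by blast
    then have "pairwise orthogonal (insert x B)"
      using B(1) by (auto simp: pairwise_insert W_def orthogonal_commute)
    moreover have "span (insert x B) = U"
    proof
      show "span (insert x B) \<subseteq> U"
        using \<open>B \<subseteq> W\<close> x less.prems(1) by (intro span_minimal) (auto simp: W_def)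
      show "U \<subseteq> span (insert x B)"
      proof
        fix y assume y: "y \<in> U"
        have "y - (x \<bullet> y) *\<^sub>R x \<in> W"
          using x y less.prems(1) unfolding W_def
          by (auto simp: orthogonal_def inner_simps dot_square_norm subspace_diff subspace_scale)
        then show "y \<in> span (insert x B)"
          using B(3) by (auto simp: span_insert)
      qed
    qed
    ultimately show ?thesis
      using B(2) x by (intro exI[of _ "insert x B"]) auto
  qed
qed

lemma symmetric_matrix_diagonalization:
  fixes S :: "real^'n^'n"
  assumes "transpose S = S"
  obtains P :: "real^'n^'n" and d where "orthogonal_matrix P"
    and "\<And>i. S *v column i P = d i *\<^sub>R column i P"
proof -
  have adj: "(S *v x) \<bullet> y = x \<bullet> (S *v y)" for x y :: "real^'n"
    by (metis assms dot_lmul_matrix vector_transpose_matrix)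
  obtain B :: "(real^'n) set" where B: "pairwise orthogonal B"
      "\<forall>b\<in>B. norm b = 1 \<and> (\<exists>\<mu>. S *v b = \<mu> *\<^sub>R b)" "span B = UNIV"
    using self_adjoint_orthonormal_eigenbasis[of "(*v) S" UNIV]
      adj matrix_vector_mul_linear[of S] by auto
  have ind: "independent B"
    using B(1,2) by (intro pairwise_orthogonal_independent) auto
  have "card B = CARD('n)"
    using dim_eq_card[OF _ ind, of UNIV] B(3) by (simp add: dim_UNIV)
  moreover have "finite B" using ind by (rule independent_imp_finite)
  ultimately obtain b where b: "bij_betw b (UNIV::'n set) B"
    using finite_same_card_bij[of "UNIV::'n set" B] by auto
  define P :: "real^'n^'n" where "P = (\<chi> i j. b j $ i)"
  have col: "column j P = b j" for j by (simp add: P_def column_def)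
  have bB: "b j \<in> B" for j using b by (auto simp: bij_betw_def)
  have "orthogonal_matrix P"
    unfolding orthogonal_matrix_orthonormal_columns col
    using B(1,2) b bB by (metis bij_betw_def injD pairwiseD)
  moreover have "\<exists>d. \<forall>i. S *v column i P = d i *\<^sub>R column i P"
    using B(2) bB col by (intro choice) metis
  ultimately show ?thesis using that by blast
qed

text \<open>The entries of \<open>x I - S\<close> are polynomials, so \<open>S P = P D\<close> is first lifted to the constant-polynomial
matrix \<open>C P\<close>, where it reads \<open>(x I - S) P = P (x I - D)\<close>. As \<open>C P\<close> is invertible, it cancels after
taking determinants.\<close>

lemma charpoly_diagonalizable:
  fixes S P :: "real^'n^'n"
  assumes P: "orthogonal_matrix P" and eig: "\<And>i. S *v column i P = d i *\<^sub>R column i P"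
  shows "charpoly S = (\<Prod>i\<in>UNIV. [:- d i, 1:])"
proof -
  define C :: "real^'n^'n \<Rightarrow> real poly^'n^'n" where "C M = (\<chi> i j. [:M $ i $ j:])" for M
  define K :: "real^'n^'n \<Rightarrow> real poly^'n^'n"
    where "K M = (\<chi> i j. (if i = j then [:0, 1:] else 0) - [:M $ i $ j:])" for M
  define D :: "real^'n^'n" where "D = (\<chi> i j. if i = j then d j else 0)"
  have sum_const: "(\<Sum>k\<in>I. [:g k:]) = [:\<Sum>k\<in>I. g k:]" for g :: "'n \<Rightarrow> real" and I
    by (induction I rule: infinite_finite_induct) auto
  have CM: "C M ** C N = C (M ** N)" for M N
    by (simp add: C_def matrix_matrix_mult_def vec_eq_iff sum_const mult.commute)
  have SP: "(\<Sum>k\<in>UNIV. S $ i $ k * P $ k $ j) = d j * P $ i $ j" for i j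
    using eig[of j] by (simp add: vec_eq_iff matrix_vector_mult_def column_def)
  have "K S ** C P = C P ** K D"
  proof -
    have "(K S ** C P) $ i $ j = (C P ** K D) $ i $ j" for i j
    proof -
      have "(K S ** C P) $ i $ j
          = (\<Sum>k\<in>UNIV. (if k = i then [:0, 1:] * [:P $ k $ j:] else 0) - [:S $ i $ k * P $ k $ j:])"
        unfolding K_def C_def matrix_matrix_mult_def
        by (simp add: left_diff_distrib) (intro sum.cong, auto)
      also have "\<dots> = [:0, 1:] * [:P $ i $ j:] - [:d j * P $ i $ j:]"
        by (simp add: sum_subtractf sum_const SP)
      also have "\<dots> = (\<Sum>k\<in>UNIV. if k = j then [:P $ i $ k:] * ([:0, 1:] - [:d j:]) else 0)"
        by (simp add: algebra_simps)
      also have "\<dots> = (C P ** K D) $ i $ j"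
        unfolding K_def C_def D_def matrix_matrix_mult_def vec_lambda_beta
        by (intro sum.cong) auto
      finally show ?thesis .
    qed
    then show ?thesis by (simp add: vec_eq_iff)
  qed
  then have "det (K S) * det (C P) = det (K D) * det (C P)"
    by (metis det_mul mult.commute)
  moreover have "det (C P) \<noteq> 0"
  proof -
    have "C (transpose P) ** C P = C (mat 1)"
      using P by (simp add: CM orthogonal_matrix_def)
    also have "\<dots> = mat 1"
      by (simp add: C_def mat_def vec_eq_iff)
    finally have "det (C (transpose P)) * det (C P) = 1"
      by (metis det_mul det_I)
    then show ?thesis by auto
  qed
  ultimately have "det (K S) = det (K D)" by simp
  also have "\<dots> = (\<Prod>i\<in>UNIV. K D $ i $ i)"
    by (rule det_diagonal) (simp add: K_def D_def)
  finally show ?thesis by (simp add: charpoly_def K_def D_def)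
qed

section \<open>Courant-Fischer subspaces and comparison of singular values\<close>

lemma norm_mult_sq: "(norm (X *v v))\<^sup>2 = v \<bullet> ((transpose X ** X) *v v)" for X :: "real^'n^'m"
  by (metis dot_lmul_matrix dot_square_norm inner_commute matrix_vector_mul_assoc
      vector_transpose_matrix transpose_transpose)

lemma norm_orthogonal_matrix_mult:
  fixes P :: "real^'n^'n"
  shows "orthogonal_matrix P \<Longrightarrow> norm (P *v w) = norm w"
  by (smt (verit) norm_mult_sq orthogonal_matrix_def matrix_vector_mul_lid dot_square_norm
      norm_ge_zero power2_eq_imp_eq)

text \<open>The orthonormal eigenvectors of \<open>X\<^sup>T X\<close> are mapped by \<open>X\<close> to orthogonal vectors whose lengths are
the singular values.\<close>

lemma right_singular_basis:
  fixes X :: "real^'n^'m"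
  obtains P :: "real^'n^'n" and s :: "'n \<Rightarrow> real"
  where "orthogonal_matrix P" "\<And>i. s i \<ge> 0"
    and "singular_values X = image_mset s (mset_set UNIV)"
    and "\<And>w. (norm (X *v (P *v w)))\<^sup>2 = (\<Sum>i\<in>UNIV. (s i * w $ i)\<^sup>2)"
proof -
  let ?S = "transpose X ** X"
  obtain P d where P: "orthogonal_matrix P" and eig: "\<And>i. ?S *v column i P = d i *\<^sub>R column i P"
    using symmetric_matrix_diagonalization[of ?S] by (auto simp: matrix_transpose_mul)
  have nc: "norm (column i P) = 1" for i
    using P by (simp add: orthogonal_matrix_orthonormal_columns)
  have "d i = (norm (X *v column i P))\<^sup>2" for i
    by (simp add: norm_mult_sq eig dot_square_norm nc)
  then have d0: "d i \<ge> 0" for i by simp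
  have "proots (charpoly ?S) = (\<Sum>i\<in>UNIV. {#d i#})"
    by (subst charpoly_diagonalizable[OF P eig], subst proots_prod) auto
  also have "\<dots> = image_mset d (mset_set UNIV)"
    using finite_class.finite_UNIV by (induction rule: finite_induct) simp_all
  finally have sv: "singular_values X = image_mset (\<lambda>i. sqrt (d i)) (mset_set UNIV)"
    by (simp add: singular_values_def multiset.map_comp o_def)
  have "(norm (X *v (P *v w)))\<^sup>2 = (\<Sum>i\<in>UNIV. (sqrt (d i) * w $ i)\<^sup>2)" for w
  proof -
    define Dw where "Dw = (\<chi> i. d i * w $ i)"
    have "P *v w = (\<Sum>i\<in>UNIV. w $ i *\<^sub>R column i P)"
      by (simp add: matrix_mult_sum scalar_mult_eq_scaleR)
    then have "?S *v (P *v w) = (\<Sum>i\<in>UNIV. w $ i *\<^sub>R (?S *v column i P))"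
      by (simp only: linear_sum[OF matrix_vector_mul_linear] linear_scale[OF matrix_vector_mul_linear])
    also have "\<dots> = P *v Dw"
      unfolding eig by (simp add: matrix_mult_sum scalar_mult_eq_scaleR Dw_def mult.commute)
    finally have "(norm (X *v (P *v w)))\<^sup>2 = (P *v w) \<bullet> (P *v Dw)"
      by (simp add: norm_mult_sq)
    also have "\<dots> = w \<bullet> Dw"
      using P by (simp add: dot_lmul_matrix[symmetric] transpose_matrix_vector[symmetric]
          matrix_vector_mul_assoc orthogonal_matrix_def)
    also have "\<dots> = (\<Sum>i\<in>UNIV. (sqrt (d i) * w $ i)\<^sup>2)"
      by (simp add: inner_vec_def Dw_def power_mult_distrib d0 power2_eq_square mult_ac)
    finally show ?thesis .
  qed
  with P d0 sv show ?thesis using that[of P "\<lambda>i. sqrt (d i)"] by simp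
qed

text \<open>Counting how many of the numbers lie on either side of the \<open>k\<close>th largest is all that is needed of
the sorted list; the counts add up to more than \<open>n\<close> because the \<open>k\<close>th largest itself lies on both sides.\<close>

lemma kth_largest_image:
  fixes s :: "'n::finite \<Rightarrow> real"
  assumes "k \<in> {1..CARD('n)}"
  defines "c \<equiv> kth_largest (image_mset s (mset_set UNIV)) k"
  shows "k \<le> card {i. c \<le> s i}" and "CARD('n) + 1 - k \<le> card {i. s i \<le> c}"
proof -
  define xs where "xs = sorted_list_of_multiset (image_mset s (mset_set UNIV))"
  have mset: "mset xs = image_mset s (mset_set UNIV)" by (simp add: xs_def)
  have len: "length xs = CARD('n)"
    by (metis mset size_mset size_image_mset size_mset_set)
  have sorted: "sorted xs" by (simp add: xs_def)
  have "k - 1 < length xs" "length xs - Suc (k - 1) = CARD('n) - k"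
    using assms(1) len by auto
  then have c: "c = xs ! (CARD('n) - k)"
    by (simp add: c_def kth_largest_def xs_def[symmetric] rev_nth)
  have card: "card {i. Q (s i)} = card {j. j < length xs \<and> Q (xs ! j)}" for Q
  proof -
    have "card {i. Q (s i)} = size (filter_mset Q (mset xs))"
      by (simp add: mset filter_mset_image_mset)
    also have "\<dots> = card {j. j < length xs \<and> Q (xs ! j)}"
      by (metis length_filter_conv_card mset_filter size_mset)
    finally show ?thesis .
  qed
  have "card {CARD('n) - k..<CARD('n)} \<le> card {j. j < length xs \<and> c \<le> xs ! j}"
    using sorted assms(1) by (intro card_mono) (auto simp: c len sorted_nth_mono)
  then show "k \<le> card {i. c \<le> s i}"
    using assms(1) by (simp add: card)
  have "card {0..CARD('n) - k} \<le> card {j. j < length xs \<and> xs ! j \<le> c}"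
    using sorted assms(1) by (intro card_mono) (auto simp: c len sorted_nth_mono)
  then show "CARD('n) + 1 - k \<le> card {i. s i \<le> c}"
    using assms(1) card[of "\<lambda>x. x \<le> c"] by simp
qed

lemma dim_orthogonal_image_coordinate_subspace:
  fixes P :: "real^'n^'n"
  assumes "orthogonal_matrix P"
  defines "T I \<equiv> (*v) P ` {w. \<forall>i. i \<notin> I \<longrightarrow> w $ i = 0}"
  shows "subspace (T I)" "dim (T I) = card I"
proof -
  let ?C = "{w::real^'n. \<forall>i. i \<notin> I \<longrightarrow> w $ i = 0}"
  have C: "subspace ?C" by (auto simp: subspace_def)
  have inj: "inj ((*v) P)"
    by (metis assms(1) matrix_left_invertible_injective orthogonal_matrix_def)
  show "subspace (T I)" unfolding T_def
    by (intro linear_subspace_image C matrix_vector_mul_linear)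
  have "dim (T I) = dim ?C" unfolding T_def
    by (intro dim_image_eq matrix_vector_mul_linear inj_on_subset[OF inj]) auto
  also have "\<dots> = card I"
    using dim_substandard_cart[where 'a = real, of I] by (simp add: dim_vec_eq)
  finally show "dim (T I) = card I" .
qed

text \<open>The two halves of the Courant-Fischer theorem that give subspaces: the span of the right singular
vectors belonging to the singular values at most, respectively at least, \<open>\<sigma>\<^sub>k\<close>.\<close>

lemma sing_val_upper_subspace:
  fixes X :: "real^'n^'m"
  assumes k: "k \<in> {1..CARD('n)}"
  obtains T where "subspace T" "dim T \<ge> CARD('n) + 1 - k"
    and "\<And>v. v \<in> T \<Longrightarrow> norm (X *v v) \<le> sing_val X k * norm v"
proof -
  obtain P :: "real^'n^'n" and s where P: "orthogonal_matrix P" and s0: "\<And>i. s i \<ge> 0"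
    and sv: "singular_values X = image_mset s (mset_set UNIV)"
    and nrm: "\<And>w. (norm (X *v (P *v w)))\<^sup>2 = (\<Sum>i\<in>UNIV. (s i * w $ i)\<^sup>2)"
    using right_singular_basis[of X] by blast
  let ?c = "sing_val X k"
  let ?I = "{i. s i \<le> ?c}"
  have card: "CARD('n) + 1 - k \<le> card ?I"
    using kth_largest_image(2)[OF k, of s] by (simp add: sing_val_def sv)
  then have "?I \<noteq> {}" using k by (intro notI) simp
  then have c0: "?c \<ge> 0" using s0 order_trans by blast
  show ?thesis
  proof (rule that)
    let ?T = "(*v) P ` {w. \<forall>i. i \<notin> ?I \<longrightarrow> w $ i = 0}"
    show "subspace ?T" by (rule dim_orthogonal_image_coordinate_subspace[OF P])
    show "dim ?T \<ge> CARD('n) + 1 - k"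
      using card dim_orthogonal_image_coordinate_subspace(2)[OF P, of ?I] by simp
    fix v assume "v \<in> ?T"
    then obtain w where w: "v = P *v w" "\<And>i. i \<notin> ?I \<Longrightarrow> w $ i = 0" by blast
    have "(norm (X *v v))\<^sup>2 \<le> (\<Sum>i\<in>UNIV. (?c * w $ i)\<^sup>2)"
      unfolding w(1) nrm
    proof (intro sum_mono)
      fix i show "(s i * w $ i)\<^sup>2 \<le> (?c * w $ i)\<^sup>2"
        using w(2)[of i] s0[of i]
        by (cases "i \<in> ?I") (auto simp: power_mult_distrib intro!: mult_right_mono power_mono)
    qed
    also have "\<dots> = (?c * norm w)\<^sup>2"
      by (simp add: power_mult_distrib power2_norm_eq_inner inner_vec_def sum_distrib_left)
        (simp add: power2_eq_square)
    finally show "norm (X *v v) \<le> ?c * norm v"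
      using c0 power2_le_imp_le[of "norm (X *v v)" "?c * norm w"]
      by (simp add: w(1) norm_orthogonal_matrix_mult[OF P])
  qed
qed

lemma sing_val_nonneg:
  fixes X :: "real^'n^'m"
  assumes k: "k \<in> {1..CARD('n)}"
  shows "0 \<le> sing_val X k"
proof -
  obtain T where T: "subspace T" "dim T \<ge> CARD('n) + 1 - k"
    and le: "\<And>v. v \<in> T \<Longrightarrow> norm (X *v v) \<le> sing_val X k * norm v"
    using sing_val_upper_subspace[OF k] by blast
  have "T \<noteq> {0}" using T(2) k by auto
  then obtain v where "v \<in> T" "v \<noteq> 0" using T(1) subspace_0 by blast
  then show ?thesis
    using le[of v] by (smt (verit) norm_ge_zero zero_less_norm_iff mult_neg_pos)
qed

lemma sing_val_lower_subspace:
  fixes X :: "real^'n^'m"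
  assumes k: "k \<in> {1..CARD('n)}"
  obtains T where "subspace T" "dim T \<ge> k"
    and "\<And>v. v \<in> T \<Longrightarrow> sing_val X k * norm v \<le> norm (X *v v)"
proof -
  obtain P :: "real^'n^'n" and s where P: "orthogonal_matrix P" and s0: "\<And>i. s i \<ge> 0"
    and sv: "singular_values X = image_mset s (mset_set UNIV)"
    and nrm: "\<And>w. (norm (X *v (P *v w)))\<^sup>2 = (\<Sum>i\<in>UNIV. (s i * w $ i)\<^sup>2)"
    using right_singular_basis[of X] by blast
  let ?c = "sing_val X k"
  let ?I = "{i. ?c \<le> s i}"
  have card: "k \<le> card ?I"
    using kth_largest_image(1)[OF k, of s] by (simp add: sing_val_def sv)
  have c0: "?c \<ge> 0" using k by (rule sing_val_nonneg)
  show ?thesis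
  proof (rule that)
    let ?T = "(*v) P ` {w. \<forall>i. i \<notin> ?I \<longrightarrow> w $ i = 0}"
    show "subspace ?T" by (rule dim_orthogonal_image_coordinate_subspace[OF P])
    show "dim ?T \<ge> k"
      using card dim_orthogonal_image_coordinate_subspace(2)[OF P, of ?I] by simp
    fix v assume "v \<in> ?T"
    then obtain w where w: "v = P *v w" "\<And>i. i \<notin> ?I \<Longrightarrow> w $ i = 0" by blast
    have "(?c * norm w)\<^sup>2 = (\<Sum>i\<in>UNIV. (?c * w $ i)\<^sup>2)"
      by (simp add: power_mult_distrib power2_norm_eq_inner inner_vec_def sum_distrib_left)
        (simp add: power2_eq_square)
    also have "\<dots> \<le> (norm (X *v v))\<^sup>2"
      unfolding w(1) nrm
    proof (intro sum_mono)
      fix i show "(?c * w $ i)\<^sup>2 \<le> (s i * w $ i)\<^sup>2"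
        using w(2)[of i] c0
        by (cases "i \<in> ?I") (auto simp: power_mult_distrib intro!: mult_right_mono power_mono)
    qed
    finally show "?c * norm v \<le> norm (X *v v)"
      using power2_le_imp_le[of "?c * norm w" "norm (X *v v)"]
      by (simp add: w(1) norm_orthogonal_matrix_mult[OF P])
  qed
qed

text \<open>The preimages under \<open>P\<close> of a \<open>k\<close>-dimensional subspace where \<open>X\<close> stretches by at least \<open>\<sigma>\<^sub>k(X)\<close>,
and under \<open>W\<close> of an \<open>(n + 1 - k)\<close>-dimensional one where \<open>Y\<close> stretches by at most \<open>\<sigma>\<^sub>k(Y)\<close>, share a
nonzero vector \<open>v\<close>; the chain of inequalities at \<open>v\<close> is the claim. Two maps are allowed because
they cover multiplication by \<open>V\<close> from either side of the inequality (take \<open>P\<close> or \<open>W\<close> to be \<open>V\<close>), and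
also two different column scalings, without any inverse matrix appearing.\<close>

lemma sing_val_compare:
  fixes X :: "real^'n^'m" and Y :: "real^'n^'q"
    and P W :: "real^'n \<Rightarrow> real^'n"
  assumes k: "k \<in> {1..CARD('n)}"
    and P: "linear P" "inj P" and W: "linear W" "inj W" and a: "0 \<le> a"
    and le: "\<And>v. norm (X *v P v) \<le> a * norm (Y *v W v)"
    and b: "\<And>v. norm (W v) \<le> b * norm (P v)"
  shows "sing_val X k \<le> a * b * sing_val Y k"
proof -
  obtain T where T: "subspace T" "dim T \<ge> k"
    and lo: "\<And>v. v \<in> T \<Longrightarrow> sing_val X k * norm v \<le> norm (X *v v)"
    using sing_val_lower_subspace[OF k] by blast
  obtain U where U: "subspace U" "dim U \<ge> CARD('n) + 1 - k"
    and up: "\<And>v. v \<in> U \<Longrightarrow> norm (Y *v v) \<le> sing_val Y k * norm v"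
    using sing_val_upper_subspace[OF k] by blast
  have pre: "subspace (f -` S) \<and> dim (f -` S) = dim S"
    if f: "linear f" "inj f" and S: "subspace S" for f :: "real^'n \<Rightarrow> real^'n" and S
  proof -
    have "surj f" using f by (simp add: linear_injective_imp_surjective)
    then have "dim S = dim (f ` (f -` S))" using surj_image_vimage_eq by metis
    also have "\<dots> = dim (f -` S)"
      using f by (intro dim_image_eq inj_on_subset[OF f(2)]) auto
    finally show ?thesis
      using linear_subspace_vimage[OF f(1) S] by simp
  qed
  let ?K = "P -` T \<inter> W -` U"
  have "dim {x + y |x y. x \<in> P -` T \<and> y \<in> W -` U} \<le> CARD('n)"
    using dim_subset_UNIV[of "{x + y |x y. x \<in> P -` T \<and> y \<in> W -` U}"] by simp
  then have "dim ?K \<ge> 1"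
    using dim_sums_Int[of "P -` T" "W -` U"] pre[OF P T(1)] pre[OF W U(1)] T(2) U(2) k
    by auto
  then have "\<not> ?K \<subseteq> {0}" by (metis dim_eq_0 not_one_le_zero)
  then obtain v where v: "P v \<in> T" "W v \<in> U" "v \<noteq> 0" by blast
  have Pv: "norm (P v) > 0"
    using v(3) P linear_injective_0[of P] by auto
  have "sing_val X k * norm (P v) \<le> norm (X *v P v)" using lo v(1) .
  also have "\<dots> \<le> a * (sing_val Y k * norm (W v))"
    using le[of v] mult_left_mono[OF up[OF v(2)] a] by simp
  also have "\<dots> \<le> a * (sing_val Y k * (b * norm (P v)))"
    using a b[of v] sing_val_nonneg[OF k, of Y] by (intro mult_left_mono) auto
  finally have "sing_val X k * norm (P v) \<le> (a * b * sing_val Y k) * norm (P v)"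
    by (simp add: mult_ac)
  then show ?thesis using Pv by (rule mult_right_le_imp_le)
qed

text \<open>For \<open>k = 1\<close> and \<open>k = n\<close> the corresponding Courant-Fischer subspace is the whole space.\<close>

lemma norm_mult_le_sing_val_1:
  fixes X :: "real^'n^'m"
  shows "norm (X *v v) \<le> sing_val X 1 * norm v"
proof -
  obtain T where T: "subspace T" "dim T \<ge> CARD('n) + 1 - 1"
    and le: "\<And>v. v \<in> T \<Longrightarrow> norm (X *v v) \<le> sing_val X 1 * norm v"
    using sing_val_upper_subspace[of 1 X] by (auto simp: Suc_le_eq)
  have "dim T = CARD('n)" using T(2) dim_subset_UNIV[of T] by simp
  then have "T = UNIV" using T(1) dim_eq_full[of T] span_eq_iff[of T] by simp
  then show ?thesis using le by simp
qed

lemma sing_val_last_le_norm_mult: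
  fixes X :: "real^'n^'m"
  shows "sing_val X CARD('n) * norm v \<le> norm (X *v v)"
proof -
  obtain T where T: "subspace T" "dim T \<ge> CARD('n)"
    and le: "\<And>v. v \<in> T \<Longrightarrow> sing_val X CARD('n) * norm v \<le> norm (X *v v)"
    using sing_val_lower_subspace[of "CARD('n)" X] by (auto simp: Suc_le_eq)
  have "dim T = CARD('n)" using T(2) dim_subset_UNIV[of T] by simp
  then have "T = UNIV" using T(1) dim_eq_full[of T] span_eq_iff[of T] by simp
  then show ?thesis using le by simp
qed

lemma sing_val_pos:
  fixes X :: "real^'n^'m"
  assumes inj: "inj ((*v) X)" and k: "k \<in> {1..CARD('n)}"
  shows "0 < sing_val X k"
proof -
  obtain T where T: "subspace T" "dim T \<ge> CARD('n) + 1 - k"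
    and le: "\<And>v. v \<in> T \<Longrightarrow> norm (X *v v) \<le> sing_val X k * norm v"
    using sing_val_upper_subspace[OF k] by blast
  have "T \<noteq> {0}" using T(2) k by auto
  then obtain v where v: "v \<in> T" "v \<noteq> 0" using T(1) subspace_0 by blast
  then have "X *v v \<noteq> 0" using inj by (metis injD matrix_vector_mult_0_right)
  then show ?thesis
    using le[OF v(1)] v(2) by (smt (verit) zero_less_norm_iff mult_nonpos_nonneg)
qed

lemma cond2_ge_1:
  fixes X :: "real^'n^'m"
  assumes "inj ((*v) X)"
  shows "1 \<le> cond2 X"
proof -
  let ?v = "axis undefined 1 :: real^'n"
  have "sing_val X CARD('n) * norm ?v \<le> sing_val X 1 * norm ?v"
    using sing_val_last_le_norm_mult norm_mult_le_sing_val_1 by (rule order_trans)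
  moreover have "0 < sing_val X CARD('n)"
    using assms by (rule sing_val_pos) (simp add: Suc_le_eq)
  ultimately show ?thesis by (simp add: cond2_def)
qed

section \<open>Relative perturbation of singular values\<close>

text \<open>This is Ostrowski's multiplicative perturbation theorem for a nearly orthogonal factor: the
hypothesis bounds \<open>\<bar>\<parallel>V v\<parallel>\<^sup>2 - \<parallel>v\<parallel>\<^sup>2\<bar>\<close> by \<open>e \<parallel>v\<parallel>\<^sup>2\<close>, and taking square roots does not increase the
relative deviation from 1.\<close>

lemma sing_val_multiplicative_perturbation:
  fixes A :: "real^'n^'m" and V :: "real^'n^'n"
  assumes k: "k \<in> {1..CARD('n)}" and e: "spectral_norm (transpose V ** V - mat 1) \<le> e" "e < 1"
  shows "\<bar>sing_val (A ** V) k - sing_val A k\<bar> \<le> e * sing_val A k" and "inj ((*v) V)"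
proof -
  let ?E = "transpose V ** V - mat 1"
  have onorm: "norm (?E *v v) \<le> e * norm v" for v
    using onorm[of "(*v) ?E" v] mult_right_mono[OF e(1), of "norm v"]
    by (simp add: spectral_norm_def matrix_vector_mul_bounded_linear)
  have e0: "0 \<le> e"
    using e(1) onorm_pos_le[of "(*v) ?E"]
    by (simp add: spectral_norm_def matrix_vector_mul_bounded_linear)
  have sq: "\<bar>(norm (V *v v))\<^sup>2 - (norm v)\<^sup>2\<bar> \<le> e * (norm v)\<^sup>2" for v
  proof -
    have "(norm (V *v v))\<^sup>2 - (norm v)\<^sup>2 = v \<bullet> (?E *v v)"
      by (simp only: norm_mult_sq matrix_vector_mult_diff_rdistrib inner_diff_right
          power2_norm_eq_inner[of v] matrix_vector_mul_lid)
    also have "\<bar>\<dots>\<bar> \<le> norm v * norm (?E *v v)"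
      by (rule Cauchy_Schwarz_ineq2)
    also have "\<dots> \<le> norm v * (e * norm v)"
      using onorm by (intro mult_left_mono) auto
    finally show ?thesis by (simp add: power2_eq_square mult_ac)
  qed
  have up: "norm (V *v v) \<le> (1 + e) * norm v" for v
  proof (rule power2_le_imp_le)
    have "(norm (V *v v))\<^sup>2 \<le> (1 + e) * (norm v)\<^sup>2"
      using sq[of v] by (simp add: algebra_simps)
    also have "\<dots> \<le> (1 + e)\<^sup>2 * (norm v)\<^sup>2"
      using e0 by (intro mult_right_mono) (auto simp: power2_eq_square)
    finally show "(norm (V *v v))\<^sup>2 \<le> ((1 + e) * norm v)\<^sup>2"
      by (simp add: power_mult_distrib)
  qed (use e0 in simp)
  have lo: "(1 - e) * norm v \<le> norm (V *v v)" for v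
  proof (rule power2_le_imp_le)
    have "((1 - e) * norm v)\<^sup>2 \<le> (1 - e) * (norm v)\<^sup>2"
      using e0 e(2) unfolding power_mult_distrib
      by (intro mult_right_mono) (auto simp: power2_eq_square intro: mult_left_le)
    also have "\<dots> \<le> (norm (V *v v))\<^sup>2"
      using sq[of v] by (simp add: algebra_simps)
    finally show "((1 - e) * norm v)\<^sup>2 \<le> (norm (V *v v))\<^sup>2" .
  qed simp
  show injV: "inj ((*v) V)"
  proof (subst linear_injective_0[OF matrix_vector_mul_linear], intro allI impI)
    fix v assume "V *v v = 0"
    then show "v = 0"
      using lo[of v] e(2) by (simp add: mult_le_0_iff)
  qed
  have "sing_val (A ** V) k \<le> 1 * (1 + e) * sing_val A k"
    by (rule sing_val_compare[OF k, where P = id and W = "(*v) V"])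
      (use up injV in \<open>auto simp: matrix_vector_mul_assoc linear_id matrix_vector_mul_linear\<close>)
  moreover have "sing_val A k \<le> 1 * (1 / (1 - e)) * sing_val (A ** V) k"
    by (rule sing_val_compare[OF k, where P = "(*v) V" and W = id])
      (use lo injV e(2) in \<open>auto simp: matrix_vector_mul_assoc linear_id matrix_vector_mul_linear field_simps\<close>)
  then have "(1 - e) * sing_val A k \<le> sing_val (A ** V) k"
    using e(2) by (simp add: field_simps)
  ultimately show "\<bar>sing_val (A ** V) k - sing_val A k\<bar> \<le> e * sing_val A k"
    by (simp add: abs_le_iff algebra_simps)
qed

lemma relatively_perturbed_norm_bounds:
  fixes X Y :: "real^'n^'m"
  assumes "\<And>v. norm ((Y - X) *v v) \<le> e * norm (X *v v)"
  shows "norm (Y *v v) \<le> (1 + e) * norm (X *v v)" and "(1 - e) * norm (X *v v) \<le> norm (Y *v v)"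
proof -
  have "norm (Y *v v - X *v v) \<le> e * norm (X *v v)"
    using assms[of v] by (simp add: matrix_vector_mult_diff_rdistrib)
  then show "norm (Y *v v) \<le> (1 + e) * norm (X *v v)" "(1 - e) * norm (X *v v) \<le> norm (Y *v v)"
    using norm_triangle_ineq2[of "Y *v v" "X *v v"] norm_triangle_ineq2[of "X *v v" "Y *v v"]
    by (simp_all add: algebra_simps norm_minus_commute)
qed

lemma sing_val_relative_perturbation:
  fixes X Y :: "real^'n^'m"
  assumes k: "k \<in> {1..CARD('n)}" and e: "0 \<le> e" "e < 1"
    and pert: "\<And>v. norm ((Y - X) *v v) \<le> e * norm (X *v v)"
  shows "\<bar>sing_val Y k - sing_val X k\<bar> \<le> e * sing_val X k"
proof -
  note bounds = relatively_perturbed_norm_bounds[OF pert]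
  have "sing_val Y k \<le> (1 + e) * 1 * sing_val X k"
    by (rule sing_val_compare[OF k, where P = id and W = id])
      (use e bounds in \<open>auto simp: linear_id\<close>)
  moreover have "sing_val X k \<le> (1 / (1 - e)) * 1 * sing_val Y k"
    by (rule sing_val_compare[OF k, where P = id and W = id])
      (use e bounds in \<open>auto simp: linear_id field_simps\<close>)
  then have "(1 - e) * sing_val X k \<le> sing_val Y k"
    using e(2) by (simp add: field_simps)
  ultimately show ?thesis
    by (simp add: abs_le_iff algebra_simps)
qed

section \<open>Matrices with normalized columns\<close>

text \<open>Multiplication by \<open>D\<^sup>-\<^sup>1\<close>, where \<open>D\<close> is the column scaling of \<open>X\<close>. Working with \<open>D\<^sup>-\<^sup>1\<close> as a map, rather
than with \<open>D\<close>, turns statements about \<open>X D\<close> into statements about \<open>X\<close> by substituting \<open>D\<^sup>-\<^sup>1 v\<close>.\<close>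

definition column_unscaling :: "real^'n^'m \<Rightarrow> real^'n \<Rightarrow> real^'n" where
  "column_unscaling X v = (\<chi> j. norm (column j X) * v $ j)"

lemma column_nonzero:
  fixes X :: "real^'n^'m"
  assumes "inj ((*v) X)"
  shows "column j X \<noteq> 0"
proof
  assume "column j X = 0"
  then have "X *v axis j 1 = X *v 0" by (simp add: matrix_vector_mult_basis)
  then have "axis j 1 = (0::real^'n)" using assms by (rule injD[rotated])
  then show False by (simp add: axis_eq_0_iff)
qed

lemma linear_column_unscaling: "linear (column_unscaling X)"
  by (intro linearI) (simp_all add: column_unscaling_def vec_eq_iff algebra_simps)

lemma inj_column_unscaling: "(\<And>j. column j X \<noteq> 0) \<Longrightarrow> inj (column_unscaling X)"
  by (intro injI) (auto simp: column_unscaling_def vec_eq_iff)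

lemma mult_column_scaling: "(X ** column_scaling X) $ i $ j = X $ i $ j / norm (column j X)"
  by (simp add: matrix_matrix_mult_def column_scaling_def if_distrib[of "(*) _"] divide_inverse cong: if_cong)

lemma mult_column_unscaling:
  fixes X :: "real^'n^'m"
  assumes "\<And>j. column j X \<noteq> 0"
  shows "(X ** column_scaling X) *v column_unscaling X v = X *v v"
proof -
  have "(X ** column_scaling X) $ i $ j * column_unscaling X v $ j = X $ i $ j * v $ j" for i j
    using assms[of j] by (simp add: mult_column_scaling column_unscaling_def)
  then show ?thesis by (simp add: matrix_vector_mult_def vec_eq_iff)
qed

lemma inj_mult_column_scaling:
  fixes X :: "real^'n^'m"
  assumes "inj ((*v) X)"
  shows "inj ((*v) (X ** column_scaling X))"
proof -
  have "surj (column_unscaling X)"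
    by (simp add: linear_injective_imp_surjective linear_column_unscaling inj_column_unscaling column_nonzero[OF assms])
  then show ?thesis
    using assms column_nonzero[OF assms] mult_column_unscaling[of X]
    by (intro injI) (metis injD surjD)
qed

lemma column_mult_column_scaling:
  "column j (X ** column_scaling X) = inverse (norm (column j X)) *\<^sub>R column j X"
  by (simp add: column_def vec_eq_iff mult_column_scaling divide_inverse mult.commute)

text \<open>The case of the comparison principle in which \<open>P\<close> and \<open>W\<close> undo the column scalings of \<open>X\<close> and \<open>Y\<close>:
the different scalings only cost the largest ratio of corresponding column norms.\<close>

lemma scaled_sing_val_compare:
  fixes X :: "real^'n^'m" and Y :: "real^'n^'q"
  assumes k: "k \<in> {1..CARD('n)}"
    and X: "inj ((*v) X)" and Y: "inj ((*v) Y)" and ab: "0 \<le> a" "0 \<le> b"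
    and le: "\<And>v. norm (X *v v) \<le> a * norm (Y *v v)"
    and b: "\<And>j. norm (column j Y) \<le> b * norm (column j X)"
  shows "sing_val (X ** column_scaling X) k \<le> a * b * sing_val (Y ** column_scaling Y) k"
proof (rule sing_val_compare[OF k linear_column_unscaling _ linear_column_unscaling _ ab(1)])
  note nz = column_nonzero[OF X] column_nonzero[OF Y]
  show "inj (column_unscaling X)" "inj (column_unscaling Y)"
    using nz by (simp_all add: inj_column_unscaling)
  fix v
  show "norm ((X ** column_scaling X) *v column_unscaling X v)
      \<le> a * norm ((Y ** column_scaling Y) *v column_unscaling Y v)"
    using le by (simp only: mult_column_unscaling[OF nz(1)] mult_column_unscaling[OF nz(2)])
  have "norm (column_unscaling Y v) \<le> norm (b *\<^sub>R column_unscaling X v)"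
  proof (rule norm_le_componentwise_cart)
    fix j
    have "norm (column j Y) * \<bar>v $ j\<bar> \<le> b * norm (column j X) * \<bar>v $ j\<bar>"
      using b by (intro mult_right_mono) auto
    then show "norm (column_unscaling Y v $ j) \<le> norm ((b *\<^sub>R column_unscaling X v) $ j)"
      using ab by (simp add: column_unscaling_def abs_mult mult_ac)
  qed
  then show "norm (column_unscaling Y v) \<le> b * norm (column_unscaling X v)"
    using ab by simp
qed

text \<open>Applied to a unit vector, the hypothesis also controls the column norms, so the normalized matrices
can be compared in both directions, each time with the factor \<open>(1 + e) / (1 - e)\<close>. One such factor
arises from the largest singular value and one from the smallest.\<close>

lemma cond2D_relative_perturbation:
  fixes X Y :: "real^'n^'m"
  assumes X: "inj ((*v) X)" and e: "0 \<le> e" "e < 1"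
    and pert: "\<And>v. norm ((Y - X) *v v) \<le> e * norm (X *v v)"
  shows "inj ((*v) Y)" and "cond2D Y \<le> ((1 + e) / (1 - e))\<^sup>2 * cond2D X"
proof -
  note bounds = relatively_perturbed_norm_bounds[OF pert]
  show Y: "inj ((*v) Y)"
  proof (subst linear_injective_0[OF matrix_vector_mul_linear], intro allI impI)
    fix v assume "Y *v v = 0"
    then have "X *v v = X *v 0"
      using bounds(2)[of v] e(2) by (simp add: mult_le_0_iff)
    then show "v = 0" using X by (rule injD[rotated])
  qed
  have col: "norm (column j Y) \<le> (1 + e) * norm (column j X)"
    "norm (column j X) \<le> 1 / (1 - e) * norm (column j Y)" for j
    using bounds[of "axis j 1"] e(2) by (simp_all add: matrix_vector_mult_basis field_simps)
  let ?XD = "X ** column_scaling X" and ?YD = "Y ** column_scaling Y"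
  let ?c = "(1 + e) / (1 - e)" and ?n = "CARD('n)"
  have c: "?c > 0" using e by simp
  have YX: "sing_val ?YD k \<le> ?c * sing_val ?XD k" if k: "k \<in> {1..?n}" for k
    using scaled_sing_val_compare[OF k Y X, of "1 + e" "1 / (1 - e)"] e bounds col by simp
  have XY: "sing_val ?XD k \<le> ?c * sing_val ?YD k" if k: "k \<in> {1..?n}" for k
    using scaled_sing_val_compare[OF k X Y, of "1 / (1 - e)" "1 + e"] e bounds col
    by (simp add: field_simps)
  have k: "1 \<in> {1..?n}" "?n \<in> {1..?n}" by (simp_all add: Suc_le_eq)
  have pos: "0 < sing_val ?XD ?n" "0 < sing_val ?YD ?n"
    using sing_val_pos[OF inj_mult_column_scaling] X Y k by blast+
  have "cond2D Y \<le> (?c * sing_val ?XD 1) / (sing_val ?XD ?n / ?c)"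
    unfolding cond2D_def cond2_def
  proof (rule frac_le)
    show "sing_val ?XD ?n / ?c \<le> sing_val ?YD ?n"
      using XY[OF k(2)] by (subst pos_divide_le_eq[OF c]) (simp only: mult.commute)
    show "0 \<le> ?c * sing_val ?XD 1" using c sing_val_nonneg[OF k(1)] by (metis less_imp_le mult_nonneg_nonneg)
    show "0 < sing_val ?XD ?n / ?c" using pos(1) c by (rule divide_pos_pos)
  qed (rule YX[OF k(1)])
  also have "\<dots> = ?c\<^sup>2 * cond2D X"
    by (simp add: cond2D_def cond2_def power2_eq_square mult_ac)
  finally show "cond2D Y \<le> ?c\<^sup>2 * cond2D X" .
qed

lemma sum_abs_le_sqrt_card_norm:
  fixes x :: "real^'n"
  shows "(\<Sum>j\<in>UNIV. \<bar>x $ j\<bar>) \<le> sqrt CARD('n) * norm x"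
proof -
  have "(\<Sum>j\<in>UNIV. \<bar>x $ j\<bar> * 1)\<^sup>2 \<le> (\<Sum>j\<in>UNIV. \<bar>x $ j\<bar>\<^sup>2) * (\<Sum>j\<in>(UNIV::'n set). 1\<^sup>2)"
    by (rule Cauchy_Schwarz_ineq_sum)
  also have "\<dots> = (sqrt CARD('n) * norm x)\<^sup>2"
    by (simp add: power_mult_distrib power2_norm_eq_inner inner_vec_def) (simp add: power2_eq_square)
  finally have "(\<Sum>j\<in>UNIV. \<bar>x $ j\<bar>)\<^sup>2 \<le> (sqrt CARD('n) * norm x)\<^sup>2" by simp
  then show ?thesis by (rule power2_le_imp_le) simp
qed

text \<open>In the coordinates \<open>y = D\<^sup>-\<^sup>1 v\<close>, all columns of \<open>E D\<close> have norm at most \<open>d\<close>, whence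
\<open>\<parallel>E v\<parallel> \<le> d \<surd>n \<parallel>y\<parallel>\<close>, while \<open>\<parallel>X v\<parallel> = \<parallel>X D y\<parallel> \<ge> \<sigma>\<^sub>n(X D) \<parallel>y\<parallel>\<close>. Since \<open>X D\<close> has unit columns,
\<open>\<sigma>\<^sub>1(X D) \<ge> 1\<close>, so \<open>1 / \<sigma>\<^sub>n(X D)\<close> is at most the scaled condition number.\<close>

lemma columnwise_error_imp_relative_perturbation:
  fixes X E :: "real^'n^'m"
  assumes X: "inj ((*v) X)" and d: "0 \<le> d"
    and E: "\<And>j. norm (column j E) \<le> d * norm (column j X)"
  shows "norm (E *v v) \<le> d * sqrt CARD('n) * cond2D X * norm (X *v v)"
proof -
  let ?XD = "X ** column_scaling X" and ?y = "column_unscaling X v"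
  have "E *v v = (\<Sum>j\<in>UNIV. v $ j *\<^sub>R column j E)"
    by (simp add: matrix_mult_sum scalar_mult_eq_scaleR)
  also have "norm \<dots> \<le> (\<Sum>j\<in>UNIV. \<bar>v $ j\<bar> * norm (column j E))"
    using norm_sum[of "\<lambda>j. v $ j *\<^sub>R column j E" UNIV] by simp
  also have "\<dots> \<le> (\<Sum>j\<in>UNIV. d * \<bar>?y $ j\<bar>)"
  proof (rule sum_mono)
    fix j
    have "\<bar>v $ j\<bar> * norm (column j E) \<le> \<bar>v $ j\<bar> * (d * norm (column j X))"
      using E by (intro mult_left_mono) auto
    then show "\<bar>v $ j\<bar> * norm (column j E) \<le> d * \<bar>?y $ j\<bar>"
      by (simp add: column_unscaling_def abs_mult mult_ac)
  qed
  also have "\<dots> \<le> d * (sqrt CARD('n) * norm ?y)"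
    using sum_abs_le_sqrt_card_norm[of ?y] d by (simp add: sum_distrib_left[symmetric] mult_left_mono)
  finally have Ev: "norm (E *v v) \<le> d * (sqrt CARD('n) * norm ?y)" .
  have "norm ?y \<le> cond2D X * norm (X *v v)"
  proof -
    let ?s = "sing_val ?XD CARD('n)"
    obtain j :: 'n where True by simp
    have pos: "0 < ?s"
      using sing_val_pos[OF inj_mult_column_scaling[OF X]] by (simp add: Suc_le_eq)
    have "1 = norm (?XD *v axis j 1)"
      using column_nonzero[OF X, of j]
      by (simp add: matrix_vector_mult_basis column_mult_column_scaling)
    also have "\<dots> \<le> sing_val ?XD 1"
      using norm_mult_le_sing_val_1[of ?XD "axis j 1"] by simp
    finally have one: "1 \<le> sing_val ?XD 1" .
    have "?s * norm ?y \<le> norm (X *v v)"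
      using sing_val_last_le_norm_mult[of ?XD ?y] mult_column_unscaling[of X v] column_nonzero[OF X] by simp
    then have "norm ?y \<le> 1 / ?s * norm (X *v v)"
      using pos by (simp add: field_simps)
    also have "\<dots> \<le> cond2D X * norm (X *v v)"
      unfolding cond2D_def cond2_def using one pos by (intro mult_right_mono divide_right_mono) auto
    finally show ?thesis .
  qed
  then have "d * (sqrt CARD('n) * norm ?y) \<le> d * (sqrt CARD('n) * (cond2D X * norm (X *v v)))"
    using d by (intro mult_left_mono) auto
  with Ev show ?thesis by (simp add: mult.assoc)
qed

section \<open>Rounding errors of the matrix product\<close>

text \<open>In a summation tree with \<open>c\<close> leaves every product passes through at most \<open>c\<close> rounded operations: its
own multiplication and at most \<open>c - 1\<close> additions. This holds for any order of summation and accounts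
for the exponent \<open>card I\<close>. At an inner node the depth grows by one, while \<open>card I + card K\<close> exceeds
both cardinalities because neither index set is empty.\<close>

lemma fl_inner_error:
  assumes "fl_inner F w x y I s" "0 \<le> w"
  shows "finite I \<and> I \<noteq> {} \<and>
    \<bar>s - (\<Sum>i\<in>I. x i * y i)\<bar> \<le> ((1 + w) ^ card I - 1) * (\<Sum>i\<in>I. \<bar>x i * y i\<bar>)"
  using assms(1)
proof induction
  case (prod i s)
  then obtain d where d: "\<bar>d\<bar> \<le> w" "s = x i * y i * (1 + d)" by (auto simp: fl_def)
  have "\<bar>s - x i * y i\<bar> = \<bar>d\<bar> * \<bar>x i * y i\<bar>"
    by (simp add: d(2) algebra_simps abs_mult)
  also have "\<dots> \<le> w * \<bar>x i * y i\<bar>" using d(1) by (rule mult_right_mono) simp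
  finally show ?case by simp
next
  case (add I s K t r)
  let ?g = "\<lambda>k. (1 + w) ^ k - 1"
  let ?S = "\<lambda>I. \<Sum>i\<in>I. x i * y i" and ?T = "\<lambda>I. \<Sum>i\<in>I. \<bar>x i * y i\<bar>"
  obtain d where d: "\<bar>d\<bar> \<le> w" "r = (s + t) * (1 + d)" using add.hyps by (auto simp: fl_def)
  have fin: "finite I" "finite K" and ne: "card I \<ge> 1" "card K \<ge> 1"
    using add.IH by (auto simp: Suc_le_eq card_gt_0_iff)
  define h where "h = card I + card K - 1"
  have T0: "0 \<le> ?T M" for M by (intro sum_nonneg) simp
  have mono: "?g k \<le> ?g h" if "k \<le> h" for k
    using that assms(2) by (simp add: power_increasing)
  have "?g (card I) * ?T I \<le> ?g h * ?T I" "?g (card K) * ?T K \<le> ?g h * ?T K"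
    using ne by (intro mult_right_mono[OF mono T0]; simp add: h_def)+
  then have st: "\<bar>(s + t) - (?S I + ?S K)\<bar> \<le> ?g h * (?T I + ?T K)"
    unfolding distrib_left using add.IH by linarith
  have S: "\<bar>?S I + ?S K\<bar> \<le> ?T I + ?T K"
    using sum_abs[of "\<lambda>i. x i * y i" I] sum_abs[of "\<lambda>i. x i * y i" K] by linarith
  have "\<bar>s + t\<bar> \<le> (?g h + 1) * (?T I + ?T K)"
    using st S by (simp add: algebra_simps)
  then have "\<bar>d\<bar> * \<bar>s + t\<bar> \<le> w * ((?g h + 1) * (?T I + ?T K))"
    using d(1) by (intro mult_mono) auto
  then have "\<bar>r - (?S I + ?S K)\<bar> \<le> ?g h * (?T I + ?T K) + w * ((?g h + 1) * (?T I + ?T K))"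
    using st by (simp add: d(2) algebra_simps abs_mult[symmetric])
  also have "\<dots> = ?g (Suc h) * (?T I + ?T K)"
    by (simp add: algebra_simps)
  also have "Suc h = card (I \<union> K)"
    using fin ne add.hyps by (simp add: h_def card_Un_disjoint)
  finally show ?case
    using fin ne add.hyps by (auto simp: sum.union_disjoint)
qed

text \<open>Bernoulli's inequality gives \<open>1 - n w \<le> (1 - w)\<^sup>n\<close>, and \<open>(1 + w)\<^sup>n (1 - w)\<^sup>n \<le> 1\<close>.\<close>

lemma power_minus_1_le_gamma:
  fixes w :: real
  assumes "0 \<le> w" "real n * w < 1"
  shows "(1 + w) ^ n - 1 \<le> real n * w / (1 - real n * w)"
proof (cases "n = 0")
  case False
  then have w1: "w \<le> 1" using assms by (smt (verit) mult_le_cancel_right1 of_nat_1 of_nat_le_iff less_one not_less)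
  have "1 - real n * w \<le> (1 - w) ^ n"
    using Bernoulli_inequality[of "- w" n] w1 by simp
  then have "(1 + w) ^ n * (1 - real n * w) \<le> (1 + w) ^ n * (1 - w) ^ n"
    using assms by (intro mult_left_mono) auto
  also have "\<dots> = (1 - w\<^sup>2) ^ n"
    by (simp add: power_mult_distrib[symmetric] algebra_simps power2_eq_square)
  also have "\<dots> \<le> 1"
    using assms(1) w1 by (intro power_le_one) (auto simp: power_le_one)
  finally show ?thesis using assms(2) by (simp add: field_simps)
qed simp

text \<open>Componentwise, the multiplication errs by at most \<open>g |A| |V|\<close> and the final rounding by \<open>u\<close> times the
entry being rounded. The \<open>j\<close>th column of \<open>|A| |V|\<close> is a combination of the columns of \<open>|A|\<close>,
which have the same norms as those of \<open>A\<close> and are therefore bounded by \<open>\<sigma>\<^sub>1(A)\<close>; only the sum of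
the moduli of the coefficients costs a factor \<open>\<surd>n\<close>.\<close>

lemma rounded_product_column_error:
  fixes A :: "real^'n^'m" and V :: "real^'p^'n" and Z C :: "real^'p^'m"
  assumes w: "0 \<le> w" "real CARD('n) * w < 1" and u: "0 \<le> u"
    and Z: "fl_matmul Fh w A V Z" and C: "fl_matrix F u Z C"
  defines "g \<equiv> real CARD('n) * w / (1 - real CARD('n) * w)"
  shows "norm (column j (C - A ** V)) \<le> u * norm (column j (A ** V))
    + (1 + u) * g * sqrt CARD('n) * sing_val A 1 * norm (column j V)"
proof -
  define a where "a k = (\<chi> i. \<bar>A $ i $ k\<bar>)" for k
  define b where "b = (\<Sum>k\<in>UNIV. \<bar>V $ k $ j\<bar> *\<^sub>R a k)"
  define p where "p = (\<chi> i. \<bar>(A ** V) $ i $ j\<bar>)"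
  have g0: "0 \<le> g" using w by (simp add: g_def)
  have bi: "b $ i = (\<Sum>k\<in>UNIV. \<bar>A $ i $ k * V $ k $ j\<bar>)" for i
    by (simp add: b_def a_def abs_mult mult.commute)
  have entry: "\<bar>C $ i $ j - (A ** V) $ i $ j\<bar> \<le> u * p $ i + (1 + u) * g * b $ i" for i
  proof -
    have b0: "0 \<le> b $ i" unfolding bi by (intro sum_nonneg) simp
    have "\<bar>Z $ i $ j - (A ** V) $ i $ j\<bar> \<le> ((1 + w) ^ CARD('n) - 1) * b $ i"
      using fl_inner_error[OF Z[unfolded fl_matmul_def, rule_format, of i j] w(1)]
      by (simp add: bi matrix_matrix_mult_def)
    also have "\<dots> \<le> g * b $ i"
      unfolding g_def using power_minus_1_le_gamma[OF w] b0 by (rule mult_right_mono)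
    finally have Zi: "\<bar>Z $ i $ j - (A ** V) $ i $ j\<bar> \<le> g * b $ i" .
    obtain d where d: "\<bar>d\<bar> \<le> u" "C $ i $ j = Z $ i $ j * (1 + d)"
      using C by (auto simp: fl_matrix_def fl_def)
    have "\<bar>C $ i $ j - Z $ i $ j\<bar> = \<bar>d\<bar> * \<bar>Z $ i $ j\<bar>"
      by (simp add: d(2) algebra_simps abs_mult)
    also have "\<dots> \<le> u * (p $ i + g * b $ i)"
      using d(1) Zi by (intro mult_mono) (auto simp: p_def)
    finally show ?thesis using Zi by (simp add: algebra_simps)
  qed
  have "norm (column j (C - A ** V)) \<le> norm (u *\<^sub>R p + ((1 + u) * g) *\<^sub>R b)"
    by (rule norm_le_componentwise_cart)
      (use entry in \<open>auto simp: column_def intro: order_trans[OF _ abs_ge_self]\<close>)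
  also have "\<dots> \<le> u * norm p + (1 + u) * g * norm b"
    using u g0 norm_triangle_ineq[of "u *\<^sub>R p" "((1 + u) * g) *\<^sub>R b"] by simp
  also have "norm p = norm (column j (A ** V))"
    by (simp add: norm_eq_sqrt_inner inner_vec_def p_def column_def)
  finally have C_le: "norm (column j (C - A ** V)) \<le> u * norm (column j (A ** V)) + (1 + u) * g * norm b" .
  have "norm b \<le> sqrt CARD('n) * sing_val A 1 * norm (column j V)"
  proof -
    have na: "norm (a k) \<le> sing_val A 1" for k
    proof -
      have "norm (a k) = norm (A *v axis k 1)"
        by (simp add: norm_eq_sqrt_inner inner_vec_def a_def column_def matrix_vector_mult_basis)
      then show ?thesis using norm_mult_le_sing_val_1[of A "axis k 1"] by simp
    qed
    have "norm b \<le> (\<Sum>k\<in>UNIV. \<bar>V $ k $ j\<bar> * norm (a k))"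
      unfolding b_def using norm_sum[of "\<lambda>k. \<bar>V $ k $ j\<bar> *\<^sub>R a k" UNIV] by simp
    also have "\<dots> \<le> (\<Sum>k\<in>UNIV. \<bar>column j V $ k\<bar> * sing_val A 1)"
      using na by (intro sum_mono) (simp add: column_def mult_left_mono)
    also have "\<dots> = (\<Sum>k\<in>UNIV. \<bar>column j V $ k\<bar>) * sing_val A 1"
      by (simp add: sum_distrib_right)
    also have "\<dots> \<le> (sqrt CARD('n) * norm (column j V)) * sing_val A 1"
      by (intro mult_right_mono sum_abs_le_sqrt_card_norm sing_val_nonneg) (simp add: Suc_le_eq)
    finally show ?thesis by (simp add: mult_ac)
  qed
  then have "(1 + u) * g * norm b \<le> (1 + u) * g * (sqrt CARD('n) * sing_val A 1 * norm (column j V))"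
    using u g0 by (intro mult_left_mono) auto
  with C_le show ?thesis by (simp add: mult.assoc)
qed

section \<open>Forward error of the computed singular values\<close>

theorem theorem2p4:
  fixes A :: "real^'n^'m" and V :: "real^'n^'n"
    and Ahcomp Acomp :: "real^'n^'m"
    and F Fh :: "real set"
    and u uh \<gamma> \<gamma>h p1 p2 p3 p3' cJ ctol :: real
    and m n :: nat
    and J :: "real^'n^'m \<Rightarrow> ('m::finite, 'n::finite) jacobi_data"
  assumes dims: "m = CARD('m)" "n = CARD('n)" "m \<ge> n"
    and full_rank: "rank A = n"
    and roundoffs: "0 < uh" "uh < u"
    and V: "spectral_norm (transpose V ** V - mat 1) \<le> p1 * u" "p1 * u < 1"
    and working_precision: "entries_in F A" "entries_in F V" "F \<subseteq> Fh"
    and product: "fl_matmul Fh uh A V Ahcomp" "fl_matrix F u Ahcomp Acomp"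
    and jacobi: "0 < ctol" "jacobi_run F u (ctol * u) Acomp (J Acomp)"
    and demmel_veselic: "demmel_veselic_bound F u (ctol * u) cJ p3' J"
    and constants: "p3 = 3 * p3'" "p2 = 3 * p3 + 3 * sqrt (real (m * n))"
    and gammas: "\<gamma> = real n * u / (1 - real n * u)" "\<gamma>h = real n * uh / (1 - real n * uh)"
      "\<gamma>h < \<gamma>" "\<gamma> < 1"
    and A1: "6 * real n * u * inverse (1 - p1 * u) * cond2 A < 1"
    and A2: "\<gamma>h < (1 - p1 * u) * u / (4 * (1 + p1 * u) * cond2 A)"
    and A3: "4 * sqrt (real m) * u < 1" "16 * real m * sqrt (real n) * u * cond2D (A ** V) < 1"
    and A4: "jacobi_cond_growth cJ (J Acomp)"
  shows "\<forall>k \<in> {1..n}. p1 * u < 1 \<longrightarrow> p2 * cond2D (A ** V) * u < 1 \<longrightarrow>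
      \<bar>computed_sing_val (J Acomp) k - sing_val A k\<bar> / sing_val A k
        \<le> p1 * u + p2 * cond2D (A ** V) * u"
proof (intro ballI impI)
  fix k assume "k \<in> {1..n}" and small: "p2 * cond2D (A ** V) * u < 1"
  then have k: "k \<in> {1..CARD('n)}" using dims by simp
  define e where "e = p1 * u"
  define X where "X = A ** V"
  define \<kappa> where "\<kappa> = cond2D X"
  define sq where "sq = sqrt (real (m * n))"
  define t where "t = sq * u * \<kappa>"
  have u0: "0 < u" using roundoffs by simp
  have mn: "1 \<le> real m" "1 \<le> real n" "real n \<le> real m"
    using dims by (simp_all add: Suc_le_eq)
  have injA: "inj ((*v) A)"
    using full_rank dims full_rank_injective[of A] by simp
  have e1: "e < 1" and eV: "spectral_norm (transpose V ** V - mat 1) \<le> e"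
    using V by (simp_all add: e_def)
  have e0: "0 \<le> e"
    using eV onorm_pos_le[of "(*v) (transpose V ** V - mat 1)"]
    by (simp add: spectral_norm_def matrix_vector_mul_bounded_linear)
  have svA: "\<bar>sing_val X j - sing_val A j\<bar> \<le> e * sing_val A j" if "j \<in> {1..CARD('n)}" for j
    unfolding X_def by (rule sing_val_multiplicative_perturbation(1)[OF that eV e1])
  have injX: "inj ((*v) X)"
  proof -
    have "(*v) X = (*v) A \<circ> (*v) V" by (auto simp: X_def matrix_vector_mul_assoc)
    then show ?thesis
      using injA sing_val_multiplicative_perturbation(2)[OF k eV e1] by (simp add: inj_compose)
  qed
  have \<kappa>1: "1 \<le> \<kappa>"
    unfolding \<kappa>_def cond2D_def by (intro cond2_ge_1 inj_mult_column_scaling injX)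

  have condA: "1 \<le> cond2 A" using injA by (rule cond2_ge_1)
  have nu: "real n * u < 1"
  proof -
    have "1 \<le> inverse (1 - e)" using e0 e1 by (simp add: one_le_inverse)
    then have "1 \<le> inverse (1 - e) * cond2 A" using condA by (metis mult_mono' mult_1 zero_le_one)
    then have "6 * real n * u * 1 \<le> 6 * real n * u * (inverse (1 - e) * cond2 A)"
      using u0 by (intro mult_left_mono) auto
    then have "6 * (real n * u) < 1" using A1 by (simp add: e_def mult.assoc)
    moreover have "0 \<le> real n * u" using u0 by simp
    ultimately show ?thesis by linarith
  qed
  have nuh: "real n * uh < 1"
    using roundoffs mn(2) nu by (smt (verit) mult_strict_left_mono)
  have u4: "u \<le> 1 / 4"
  proof -
    have "1 * u \<le> sqrt (real m) * u" using mn(1) u0 by (intro mult_right_mono) auto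
    then show ?thesis using A3(1) by linarith
  qed

  have sq: "sqrt (real n) \<le> sq" "real n \<le> sq" "sq \<le> real m * sqrt (real n)" "0 \<le> sq"
  proof -
    show "sqrt (real n) \<le> sq" using mn by (simp add: sq_def)
    have "sqrt (real n * real n) \<le> sq" unfolding sq_def using mn by (intro real_sqrt_le_mono) simp
    then show "real n \<le> sq" by simp
    have "sqrt (real m) \<le> real m" using mn(1) by (intro real_le_lsqrt) (auto simp: power2_eq_square)
    then show "sq \<le> real m * sqrt (real n)" unfolding sq_def
      by (simp add: real_sqrt_mult mult_right_mono)
  qed (simp add: sq_def)
  have t: "0 \<le> t" "t \<le> 1 / 16"
  proof -
    show "0 \<le> t" using sq(4) u0 \<kappa>1 by (simp add: t_def)
    have "t \<le> real m * sqrt (real n) * u * \<kappa>"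
      unfolding t_def using sq(3) u0 \<kappa>1 by (intro mult_right_mono) auto
    then show "t \<le> 1 / 16" using A3(2) by (simp add: \<kappa>_def X_def)
  qed

  have gh0: "0 \<le> \<gamma>h" using roundoffs nuh by (simp add: gammas(2))
  \<comment> \<open>the precision of the product is matched to the condition number of \<open>A\<close>\<close>
  have gh: "\<gamma>h * cond2 A \<le> u / 4"
  proof -
    have "\<gamma>h * cond2 A \<le> (1 - e) * u / (4 * (1 + e) * cond2 A) * cond2 A"
      using A2 condA by (intro mult_right_mono) (auto simp: e_def)
    also have "\<dots> = (1 - e) / (1 + e) * (u / 4)"
      using condA by (simp add: mult.commute)
    also have "\<dots> \<le> 1 * (u / 4)"
      using e0 u0 by (intro mult_right_mono) auto
    finally show ?thesis by simp
  qed
  \<comment> \<open>the relative error of the columns of the computed product\<close>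
  define d where "d = u + (1 + u) * sqrt (real n) * (u / 4)"
  have d0: "0 \<le> d" using u0 by (simp add: d_def)
  have column: "norm (column j (Acomp - X)) \<le> d * norm (column j X)" for j
  proof -
    let ?v = "norm (column j V)" and ?x = "norm (column j X)"
    have pos: "0 < sing_val A CARD('n)"
      using injA by (rule sing_val_pos) (simp add: Suc_le_eq)
    have "column j X = A *v column j V"
      by (metis X_def matrix_vector_mul_assoc matrix_vector_mult_basis)
    then have "sing_val A CARD('n) * ?v \<le> ?x"
      using sing_val_last_le_norm_mult[of A "column j V"] by simp
    then have "cond2 A * (sing_val A CARD('n) * ?v) \<le> cond2 A * ?x"
      using condA by (intro mult_left_mono) auto
    then have "sing_val A 1 * ?v \<le> cond2 A * ?x"
      using pos by (simp add: cond2_def)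
    then have "\<gamma>h * (sing_val A 1 * ?v) \<le> \<gamma>h * (cond2 A * ?x)"
      using gh0 by (rule mult_left_mono)
    also have "\<dots> \<le> (u / 4) * ?x"
      using mult_right_mono[OF gh, of ?x] by (simp add: mult.assoc)
    finally have "((1 + u) * sqrt (real n)) * (\<gamma>h * (sing_val A 1 * ?v))
        \<le> ((1 + u) * sqrt (real n)) * ((u / 4) * ?x)"
      using u0 by (intro mult_left_mono) auto
    moreover have "norm (column j (Acomp - X)) \<le> u * ?x
        + (1 + u) * \<gamma>h * sqrt (real n) * sing_val A 1 * ?v"
      using rounded_product_column_error[OF _ _ _ product, of j] roundoffs nuh
      by (simp add: X_def gammas(2) dims)
    ultimately show ?thesis by (simp add: d_def algebra_simps)
  qed
  \<comment> \<open>the same error measured against \<open>\<parallel>X v\<parallel>\<close> for arbitrary \<open>v\<close>\<close>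
  define h where "h = d * sqrt (real n) * \<kappa>"
  have pert: "norm ((Acomp - X) *v v) \<le> h * norm (X *v v)" for v
    unfolding h_def \<kappa>_def dims(2)
    by (rule columnwise_error_imp_relative_perturbation[OF injX d0 column])
  have h0: "0 \<le> h" using d0 \<kappa>1 by (simp add: h_def)
  have h: "h \<le> 21 / 16 * t"
  proof -
    have "d * sqrt (real n) = (sqrt (real n) + (1 + u) / 4 * real n) * u"
      by (simp add: d_def algebra_simps)
    also have "\<dots> \<le> (sq + 5 / 16 * sq) * u"
      using sq u4 u0 by (intro mult_right_mono add_mono mult_mono) auto
    finally have "d * sqrt (real n) \<le> 21 / 16 * sq * u" by simp
    then have "h \<le> 21 / 16 * sq * u * \<kappa>"
      unfolding h_def using \<kappa>1 by (intro mult_right_mono) auto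
    then show ?thesis by (simp add: t_def mult.assoc)
  qed
  have h1: "h \<le> 21 / 256" using h t(2) by simp

  have injC: "inj ((*v) Acomp)" and
    cC: "cond2D Acomp \<le> ((1 + h) / (1 - h))\<^sup>2 * \<kappa>"
    unfolding \<kappa>_def using cond2D_relative_perturbation[OF injX h0 _ pert] h1 by auto
  \<comment> \<open>\<open>h \<le> 21/256\<close> makes the quotient at most \<open>277/235\<close>, which is below \<open>6/5\<close>\<close>
  have "((1 + h) / (1 - h))\<^sup>2 \<le> (6 / 5)\<^sup>2"
    using h0 h1 by (intro power_mono) (auto simp: pos_divide_le_eq)
  also have "\<dots> \<le> (3 / 2 :: real)"
    by (simp add: power2_eq_square)
  finally have "((1 + h) / (1 - h))\<^sup>2 * \<kappa> \<le> 3 / 2 * \<kappa>"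
    using \<kappa>1 by (intro mult_right_mono) auto
  with cC have condC: "cond2D Acomp \<le> 3 / 2 * \<kappa>" by (rule order_trans)
  have condC1: "1 \<le> cond2D Acomp"
    unfolding cond2D_def by (intro cond2_ge_1 inj_mult_column_scaling injC)
  \<comment> \<open>the relative error made by the Jacobi algorithm\<close>
  define r where "r = p3' * u * cond2D Acomp"
  have DV: "\<bar>computed_sing_val (J Acomp) j - sing_val Acomp j\<bar> / sing_val Acomp j \<le> r"
    if "r < 1" and "j \<in> {1..CARD('n)}" for j
  proof -
    have "entries_in F Acomp"
      using product(2) by (simp add: fl_matrix_def entries_in_def fl_def)
    moreover have "full_column_rank Acomp"
      using injC full_rank_injective[of Acomp] by (simp add: full_column_rank_def)
    ultimately show ?thesis
      using demmel_veselic jacobi(2) A4 that unfolding demmel_veselic_bound_def r_def by blast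
  qed
  have svC: "0 < sing_val Acomp k" and svA0: "0 < sing_val A k"
    using sing_val_pos injC injA k by blast+
  \<comment> \<open>a negative factor would make the Demmel-Veselic bound on an absolute value negative\<close>
  have p3': "0 \<le> p3'"
  proof (rule ccontr)
    assume "\<not> 0 \<le> p3'"
    then have "r < 0" using u0 condC1 by (simp add: r_def mult_neg_pos)
    then show False using DV[OF _ k] svC by (smt (verit) divide_nonneg_pos abs_ge_zero)
  qed
  define q where "q = p3' * u * \<kappa>"
  have q0: "0 \<le> q" using p3' u0 \<kappa>1 by (simp add: q_def)
  have p2: "p2 * \<kappa> * u = 9 * q + 3 * t"
    by (simp add: constants q_def t_def sq_def algebra_simps)
  have r0: "0 \<le> r" using p3' u0 condC1 by (simp add: r_def)
  have r: "r \<le> 3 / 2 * q"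
    using mult_left_mono[OF condC, of "p3' * u"] p3' u0 by (simp add: r_def q_def mult_ac)
  have "9 * q < 1" using small p2 t(1) by (simp add: \<kappa>_def X_def)
  then have "r < 1" using r by linarith
  let ?s = "sing_val A k" and ?s1 = "sing_val X k" and ?s2 = "sing_val Acomp k"
    and ?c = "computed_sing_val (J Acomp) k"
  have s1: "\<bar>?s1 - ?s\<bar> \<le> e * ?s" using svA[OF k] .
  have s2: "\<bar>?s2 - ?s1\<bar> \<le> h * ?s1"
    using sing_val_relative_perturbation[OF k h0 _ pert] h1 by simp
  have c: "\<bar>?c - ?s2\<bar> \<le> r * ?s2"
    using DV[OF \<open>r < 1\<close> k] svC by (simp add: pos_divide_le_eq)
  have "e * ?s \<le> 1 * ?s" using e1 svA0 by (intro mult_right_mono) auto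
  then have s1_le: "?s1 \<le> 2 * ?s" using s1 by linarith
  have "h * ?s1 \<le> h * (2 * ?s)" using s1_le h0 by (rule mult_left_mono)
  then have hs1: "h * ?s1 \<le> 2 * h * ?s" by simp
  have "2 * h * ?s \<le> 1 * ?s" using h1 svA0 by (intro mult_right_mono) auto
  then have s2_le: "?s2 \<le> 3 * ?s" using s2 hs1 s1_le by linarith
  have "r * ?s2 \<le> r * (3 * ?s)" using s2_le r0 by (rule mult_left_mono)
  then have "\<bar>?c - ?s\<bar> \<le> (e + 2 * h + 3 * r) * ?s"
    using c s1 s2 hs1 by (simp add: algebra_simps)
  also have "\<dots> \<le> (e + p2 * \<kappa> * u) * ?s"
    unfolding p2 using h r q0 t(1) svA0 by (intro mult_right_mono) auto
  finally show "\<bar>?c - ?s\<bar> / ?s \<le> p1 * u + p2 * cond2D (A ** V) * u"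
    using svA0 by (simp add: pos_divide_le_eq e_def \<kappa>_def X_def)
qed

end
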